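(* Let $\triangle ABC$ be an arbitrary triangle with side lengths $a$, $b$ and $c$. Let $h_a, h_b, h_c$ be the lengths of the altitudes to the sides $a, b, c$ respectively, and let $m_a, m_b, m_c$ be the lengths of the medians to the sides $a, b, c$ respectively. Then the following two inequalities hold: $$a h_a + b h_b + c h_c \le \sqrt{bc}\, h_a + \sqrt{ac}\, h_b + \sqrt{ab}\, h_c,$$ $$a m_a + b m_b + c m_c \le \sqrt{bc}\, m_a + \sqrt{ac}\, m_b + \sqrt{ab}\, m_c.$$
   Context: The triangle is a (non-degenerate) triangle in the Euclidean plane. The altitude $h_a$ to side $a$ is the distance from the vertex opposite that side to the line containing it, so $a h_a = b h_b = c h_c = 2S$, where $S$ is the area of the triangle. The median $m_a$ to side $a$ is the length of the segment joining the opposite vertex to the midpoint of that side, so $m_a = \frac{1}{2}\sqrt{2b^2+2c^2-a^2}$, $m_b = \frac{1}{2}\sqrt{2a^2+2c^2-b^2}$, $m_c = \frac{1}{2}\sqrt{2a^2+2b^2-c^2}$. *)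

theory Defs
  imports "HOL-Analysis.Analysis"
begin

definition altitude :: "real ^ 2 \<Rightarrow> real ^ 2 \<Rightarrow> real ^ 2 \<Rightarrow> real" where
  "altitude P Q R = infdist P (affine hull {Q, R})"

definition median :: "real ^ 2 \<Rightarrow> real ^ 2 \<Rightarrow> real ^ 2 \<Rightarrow> real" where
  "median P Q R = dist P (midpoint Q R)"

end

theory Submission
  imports Defs
begin

text \<open>
  Put \<open>x = \<surd>a\<close>, \<open>y = \<surd>b\<close>, \<open>z = \<surd>c\<close>, and let \<open>u, v, w\<close> be the altitudes, or the medians, to
  the sides \<open>a, b, c\<close>. Each of the two inequalities says that \<open>\<Sum> (x\<^sup>2 - y z) u \<le> 0\<close>, and the splitting
  \<open>2 (x\<^sup>2 - y z) = (x - y) (x + z) + (x - z) (x + y)\<close> turns twice this sum into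
  \<open>\<Sum> (x - y) ((x + z) u - (y + z) v)\<close>, a sum with one term for each pair of sides. It therefore
  suffices that the longer of two sides has the smaller weighted cevian: \<open>(x + z) u \<le> (y + z) v\<close>
  whenever \<open>y \<le> x\<close> (lemma \<open>cevian_sum_le\<close>).

  For altitudes this holds because \<open>x\<^sup>2 u = y\<^sup>2 v\<close> is twice the area and \<open>t \<mapsto> (t + z) / t\<^sup>2\<close> is
  decreasing (lemma \<open>weighted_altitude_le\<close>). For medians one squares both sides; the difference is
  then a polynomial in \<open>x, y, z\<close> with the factor \<open>x - y\<close>, and the triangle inequality
  \<open>c \<le> a + b\<close> makes the cofactor nonpositive (lemma \<open>weighted_median_le_ordered\<close>).
\<close>

section \<open>Reduction to pairs of sides\<close>

text \<open>Both inequalities are instances of this one: \<open>r, s, t\<close> are the square roots of the sides.\<close>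

lemma sum_le_of_pairwise_weighted_le:
  fixes r s t u v w :: real
  assumes "(r - s) * ((r + t) * u - (s + t) * v) \<le> 0"
    and "(s - t) * ((s + r) * v - (t + r) * w) \<le> 0"
    and "(t - r) * ((t + s) * w - (r + s) * u) \<le> 0"
  shows "r\<^sup>2 * u + s\<^sup>2 * v + t\<^sup>2 * w \<le> s * t * u + r * t * v + r * s * w"
proof -
  have "2 * (r\<^sup>2 * u + s\<^sup>2 * v + t\<^sup>2 * w - (s * t * u + r * t * v + r * s * w)) =
      (r - s) * ((r + t) * u - (s + t) * v) + (s - t) * ((s + r) * v - (t + r) * w)
      + (t - r) * ((t + s) * w - (r + s) * u)"
    by (simp add: algebra_simps power2_eq_square)
  also have "\<dots> \<le> 0"
    using assms by (intro add_nonpos_nonpos)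
  finally show ?thesis
    by simp
qed

lemma cevian_sum_le:
  fixes a b c u v w :: real
  assumes pos: "0 \<le> a" "0 \<le> b" "0 \<le> c"
    and "(sqrt a - sqrt b) * ((sqrt a + sqrt c) * u - (sqrt b + sqrt c) * v) \<le> 0"
    and "(sqrt b - sqrt c) * ((sqrt b + sqrt a) * v - (sqrt c + sqrt a) * w) \<le> 0"
    and "(sqrt c - sqrt a) * ((sqrt c + sqrt b) * w - (sqrt a + sqrt b) * u) \<le> 0"
  shows "a * u + b * v + c * w \<le> sqrt (b * c) * u + sqrt (a * c) * v + sqrt (a * b) * w"
  using sum_le_of_pairwise_weighted_le[OF assms(4-6)] pos by (simp add: real_sqrt_mult)

section \<open>Altitudes\<close>

text \<open>
  Twice the area of a triangle is the square root of the Gram determinant of two edge vectors. This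
  form makes it easy to see that the product of side and altitude is the same for all three sides.
\<close>

lemma side_mult_altitude:
  assumes "Q \<noteq> R"
  shows "(dist Q R * altitude P Q R)\<^sup>2
    = ((P - Q) \<bullet> (P - Q)) * ((R - Q) \<bullet> (R - Q)) - ((P - Q) \<bullet> (R - Q))\<^sup>2"
proof -
  define p where "p = P - Q"
  define d where "d = R - Q"
  \<comment> \<open>the parameter of the foot of the perpendicular from \<open>P\<close>\<close>
  define k where "k = (p \<bullet> d) / (d \<bullet> d)"
  have dd: "d \<bullet> d > 0"
    using assms by (simp add: d_def)
  have line: "affine hull {Q, R} = range (\<lambda>s. Q + s *\<^sub>R d)"
    by (simp add: affine_hull_2_alt d_def)
  have dist_line: "(dist P (Q + s *\<^sub>R d))\<^sup>2 = p \<bullet> p - (p \<bullet> d)\<^sup>2 / (d \<bullet> d) + (s - k)\<^sup>2 * (d \<bullet> d)" for s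
  proof -
    have "dist P (Q + s *\<^sub>R d) = norm (p - s *\<^sub>R d)"
      by (simp add: dist_norm p_def algebra_simps)
    then have "(dist P (Q + s *\<^sub>R d))\<^sup>2 = (p - s *\<^sub>R d) \<bullet> (p - s *\<^sub>R d)"
      by (simp add: power2_norm_eq_inner)
    also have "\<dots> = p \<bullet> p - 2 * s * (p \<bullet> d) + s\<^sup>2 * (d \<bullet> d)"
      by (simp add: inner_diff_left inner_diff_right inner_commute algebra_simps power2_eq_square)
    also have "\<dots> = p \<bullet> p - (p \<bullet> d)\<^sup>2 / (d \<bullet> d) + (s - k)\<^sup>2 * (d \<bullet> d)"
      using dd by (simp add: k_def field_simps power2_eq_square)
    finally show ?thesis .
  qed
  have "altitude P Q R = dist P (Q + k *\<^sub>R d)"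
  proof (rule antisym)
    show "altitude P Q R \<le> dist P (Q + k *\<^sub>R d)"
      unfolding altitude_def line by (rule infdist_le) auto
    have "dist P (Q + k *\<^sub>R d) \<le> dist P (Q + s *\<^sub>R d)" for s
      by (rule power2_le_imp_le) (use dd in \<open>simp_all add: dist_line\<close>)
    then show "dist P (Q + k *\<^sub>R d) \<le> altitude P Q R"
      unfolding altitude_def line infdist_def by (auto intro!: cINF_greatest)
  qed
  moreover have "(dist Q R)\<^sup>2 = d \<bullet> d"
    by (simp add: d_def dist_norm norm_minus_commute[of Q] power2_norm_eq_inner)
  ultimately have "(dist Q R * altitude P Q R)\<^sup>2 = (d \<bullet> d) * (p \<bullet> p - (p \<bullet> d)\<^sup>2 / (d \<bullet> d))"
    by (simp add: power_mult_distrib dist_line)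
  also have "\<dots> = (p \<bullet> p) * (d \<bullet> d) - (p \<bullet> d)\<^sup>2"
    using dd by (simp add: field_simps)
  finally show ?thesis
    by (simp add: p_def d_def)
qed

lemma altitude_nonneg: "0 \<le> altitude P Q R"
  by (simp add: altitude_def infdist_nonneg)

lemma side_mult_altitude_rotate:
  assumes "Q \<noteq> R" "R \<noteq> P"
  shows "dist Q R * altitude P Q R = dist R P * altitude Q R P"
proof (rule power2_eq_imp_eq)
  show "(dist Q R * altitude P Q R)\<^sup>2 = (dist R P * altitude Q R P)\<^sup>2"
    unfolding side_mult_altitude[OF assms(1)] side_mult_altitude[OF assms(2)]
    by (simp add: inner_diff_left inner_diff_right inner_commute algebra_simps power2_eq_square)
qed (simp_all add: altitude_nonneg)

lemma weighted_altitude_le: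
  fixes a b c g h :: real
  assumes "0 < a" "0 < b" "0 \<le> c" "0 \<le> g" "0 \<le> h" and area: "a * g = b * h"
  shows "(sqrt a - sqrt b) * ((sqrt a + sqrt c) * g - (sqrt b + sqrt c) * h) \<le> 0"
proof -
  define x where "x = sqrt a"
  define y where "y = sqrt b"
  define z where "z = sqrt c"
  have nonneg: "0 < x" "0 < y" "0 \<le> z"
    using assms by (simp_all add: x_def y_def z_def)
  have g: "g = b * h / a"
    using assms by (simp add: field_simps)
  have sq: "a = x\<^sup>2" "b = y\<^sup>2"
    using assms by (simp_all add: x_def y_def)
  have "(x - y) * ((x + z) * g - (y + z) * h) = - ((x - y)\<^sup>2 * (h * (x * y + z * (x + y)) / x\<^sup>2))"
    using nonneg unfolding g sq by (simp add: field_simps power2_eq_square)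
  also have "\<dots> \<le> 0"
    using nonneg assms by simp
  finally show ?thesis
    by (simp add: x_def y_def z_def)
qed

section \<open>Medians\<close>

lemma median_nonneg: "0 \<le> median P Q R"
  by (simp add: median_def)

lemma median_square:
  "4 * (median P Q R)\<^sup>2 = 2 * (dist R P)\<^sup>2 + 2 * (dist P Q)\<^sup>2 - (dist Q R)\<^sup>2"
  by (simp add: median_def midpoint_def dist_norm power2_norm_eq_inner inner_diff_left
      inner_diff_right inner_add_left inner_add_right inner_commute algebra_simps)

text \<open>
  The two squares differ by \<open>(x - y) F\<close>, up to a factor \<open>4\<close>. The only positive contributions to \<open>F\<close>
  are the terms in \<open>c\<^sup>2 = z\<^sup>4\<close>; the triangle inequality, used in the form \<open>z\<^sup>2 \<le> x\<^sup>2 + y\<^sup>2\<close> and in its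
  consequence \<open>z \<le> x + y\<close>, bounds them by the others.
\<close>

lemma weighted_median_le_ordered:
  fixes x y z m n :: real
  assumes "0 \<le> y" "y \<le> x" "0 \<le> z" "0 \<le> n"
    and triangle: "z\<^sup>2 \<le> x\<^sup>2 + y\<^sup>2"
    and m: "4 * m\<^sup>2 = 2 * (y\<^sup>2)\<^sup>2 + 2 * (z\<^sup>2)\<^sup>2 - (x\<^sup>2)\<^sup>2"
    and n: "4 * n\<^sup>2 = 2 * (x\<^sup>2)\<^sup>2 + 2 * (z\<^sup>2)\<^sup>2 - (y\<^sup>2)\<^sup>2"
  shows "(x + z) * m \<le> (y + z) * n"
proof (rule power2_le_imp_le)
  define a where "a = x\<^sup>2"
  define b where "b = y\<^sup>2"
  define c where "c = z\<^sup>2"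
  define P where "P = 2 * c\<^sup>2 - a\<^sup>2 - b\<^sup>2 - 3 * a * b"
  define F where "F = (x + y) * (2 * c\<^sup>2 - a\<^sup>2 - 3 * a * b - b\<^sup>2 - 3 * c * (a + b))
    + 2 * z * (P - 3 * x * y * (a + b))"
  have nonneg: "0 \<le> a" "0 \<le> b" "0 \<le> c" "0 \<le> x"
    using assms by (simp_all add: a_def b_def c_def)
  have c_le: "c \<le> a + b"
    using triangle by (simp add: a_def b_def c_def)
  have z_le: "z \<le> x + y"
  proof (rule power2_le_imp_le)
    have "0 \<le> x * y"
      using assms by simp
    then show "z\<^sup>2 \<le> (x + y)\<^sup>2"
      using triangle by (simp add: power2_sum)
  qed (use assms in simp)
  have c1: "c\<^sup>2 \<le> c * (a + b)"
    using c_le nonneg by (simp add: power2_eq_square mult_left_mono)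
  have c2: "c\<^sup>2 \<le> (a + b)\<^sup>2"
    using c_le nonneg by (simp add: power_mono)
  have ab: "0 \<le> a * b"
    using nonneg by simp
  have c3: "0 \<le> c * (a + b)"
    using nonneg by simp
  have P_le: "2 * P \<le> c * (a + b) + a\<^sup>2 + 3 * a * b + b\<^sup>2"
  proof -
    have "2 * P = 4 * c\<^sup>2 - 2 * a\<^sup>2 - 2 * b\<^sup>2 - 6 * (a * b)"
      by (simp add: P_def)
    \<comment> \<open>\<open>c\<^sup>2\<close> is estimated once by \<open>c (a + b)\<close> and three times by \<open>(a + b)\<^sup>2\<close>\<close>
    also have "\<dots> \<le> c * (a + b) + 3 * (a + b)\<^sup>2 - 2 * a\<^sup>2 - 2 * b\<^sup>2 - 6 * (a * b)"
      using c1 c2 by linarith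
    also have "\<dots> = c * (a + b) + a\<^sup>2 + b\<^sup>2"
      by (simp add: algebra_simps power2_eq_square)
    finally show ?thesis
      using ab by linarith
  qed
  have zP: "2 * z * P \<le> (x + y) * (c * (a + b) + a\<^sup>2 + 3 * a * b + b\<^sup>2)"
  proof (cases "0 \<le> P")
    case True
    have "z * (2 * P) \<le> (x + y) * (c * (a + b) + a\<^sup>2 + 3 * a * b + b\<^sup>2)"
      by (rule mult_mono[OF z_le P_le]) (use True assms in simp_all)
    then show ?thesis
      by (simp add: algebra_simps)
  next
    case False
    have "2 * z * P \<le> 0"
      using False assms by (intro mult_nonneg_nonpos) auto
    moreover have "0 \<le> (x + y) * (c * (a + b) + a\<^sup>2 + 3 * a * b + b\<^sup>2)"
      using nonneg assms by simp
    ultimately show ?thesis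
      by linarith
  qed
  have "(x + y) * (2 * c\<^sup>2 - a\<^sup>2 - 3 * a * b - b\<^sup>2 - 3 * c * (a + b))
      \<le> (x + y) * - (c * (a + b) + a\<^sup>2 + 3 * a * b + b\<^sup>2)"
    using c1 nonneg assms by (intro mult_left_mono) auto
  moreover have "0 \<le> 2 * z * (3 * x * y * (a + b))"
    using nonneg assms by simp
  moreover have "2 * z * (P - 3 * x * y * (a + b)) = 2 * z * P - 2 * z * (3 * x * y * (a + b))"
    by (simp add: algebra_simps)
  ultimately have "F \<le> 0"
    using zP unfolding F_def mult_minus_right by linarith
  have "4 * ((x + z) * m)\<^sup>2 - 4 * ((y + z) * n)\<^sup>2
      = (x + z)\<^sup>2 * (4 * m\<^sup>2) - (y + z)\<^sup>2 * (4 * n\<^sup>2)"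
    by (simp add: power_mult_distrib)
  also have "\<dots> = (x - y) * F"
    unfolding m n F_def P_def a_def b_def c_def
    by (simp add: algebra_simps power2_eq_square)
  also have "\<dots> \<le> 0"
    using \<open>F \<le> 0\<close> assms by (intro mult_nonneg_nonpos) auto
  finally show "((x + z) * m)\<^sup>2 \<le> ((y + z) * n)\<^sup>2"
    by simp
qed (use assms in simp)

lemma weighted_median_le:
  fixes a b c m n :: real
  assumes nonneg: "0 \<le> a" "0 \<le> b" "0 \<le> c" "0 \<le> m" "0 \<le> n" and triangle: "c \<le> a + b"
    and m: "4 * m\<^sup>2 = 2 * b\<^sup>2 + 2 * c\<^sup>2 - a\<^sup>2"
    and n: "4 * n\<^sup>2 = 2 * a\<^sup>2 + 2 * c\<^sup>2 - b\<^sup>2"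
  shows "(sqrt a - sqrt b) * ((sqrt a + sqrt c) * m - (sqrt b + sqrt c) * n) \<le> 0"
proof (cases "sqrt b \<le> sqrt a")
  case True
  have "(sqrt a + sqrt c) * m \<le> (sqrt b + sqrt c) * n"
    by (rule weighted_median_le_ordered) (use True assms in simp_all)
  then show ?thesis
    using True by (intro mult_nonneg_nonpos) auto
next
  case False
  have "(sqrt b + sqrt c) * n \<le> (sqrt a + sqrt c) * m"
    by (rule weighted_median_le_ordered) (use False assms in simp_all)
  then show ?thesis
    using False by (intro mult_nonpos_nonneg) auto
qed

section \<open>The two inequalities\<close>

theorem theorem1:
  fixes A B C :: "real ^ 2"
    and a b c h_a h_b h_c m_a m_b m_c :: real
  assumes "\<not> collinear {A, B, C}"
    and "a = dist B C" and "b = dist C A" and "c = dist A B"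
    and "h_a = altitude A B C" and "h_b = altitude B C A" and "h_c = altitude C A B"
    and "m_a = median A B C" and "m_b = median B C A" and "m_c = median C A B"
  shows "a * h_a + b * h_b + c * h_c
           \<le> sqrt (b * c) * h_a + sqrt (a * c) * h_b + sqrt (a * b) * h_c \<and>
         a * m_a + b * m_b + c * m_c
           \<le> sqrt (b * c) * m_a + sqrt (a * c) * m_b + sqrt (a * b) * m_c"
proof
  have distinct: "B \<noteq> C" "C \<noteq> A" "A \<noteq> B"
    using assms(1) by (auto simp: insert_commute)
  then have pos: "0 < a" "0 < b" "0 < c"
    using assms(2-4) by simp_all
  have h_nonneg: "0 \<le> h_a" "0 \<le> h_b" "0 \<le> h_c"
    using assms(5-7) by (simp_all add: altitude_nonneg)
  have area: "a * h_a = b * h_b" "b * h_b = c * h_c" "c * h_c = a * h_a"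
    unfolding assms(2-7) using distinct by (blast intro: side_mult_altitude_rotate)+
  show "a * h_a + b * h_b + c * h_c
      \<le> sqrt (b * c) * h_a + sqrt (a * c) * h_b + sqrt (a * b) * h_c"
    by (intro cevian_sum_le weighted_altitude_le) (use pos h_nonneg area in simp_all)
  have m_nonneg: "0 \<le> m_a" "0 \<le> m_b" "0 \<le> m_c"
    using assms(8-10) by (simp_all add: median_nonneg)
  have m_square: "4 * m_a\<^sup>2 = 2 * b\<^sup>2 + 2 * c\<^sup>2 - a\<^sup>2" "4 * m_b\<^sup>2 = 2 * c\<^sup>2 + 2 * a\<^sup>2 - b\<^sup>2"
    "4 * m_c\<^sup>2 = 2 * a\<^sup>2 + 2 * b\<^sup>2 - c\<^sup>2"
    unfolding assms(2-4,8-10) by (rule median_square)+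
  have triangle: "c \<le> a + b" "a \<le> b + c" "b \<le> c + a"
    unfolding assms(2-4) by (metis add.commute dist_commute dist_triangle)+
  show "a * m_a + b * m_b + c * m_c
      \<le> sqrt (b * c) * m_a + sqrt (a * c) * m_b + sqrt (a * b) * m_c"
    by (intro cevian_sum_le weighted_median_le) (use pos m_nonneg m_square triangle in simp_all)
qed

end
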